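(* Assume that the policy is proper, that $\Phi_J$ has rank $l_J$ and $\Phi_M$ has rank $l_M$, and that $q(x)>0$ for all $x\in X$. Let $\alpha\in(0,1)$ and $\beta<1$ be such that $\Pi T$ is a $\beta$-contraction with respect to the $\alpha$-weighted norm, i.e. $\|\Pi Tz_1-\Pi Tz_2\|_\alpha\le\beta\|z_1-z_2\|_\alpha$ for all $z_1,z_2\in\mathbb{R}^{2n}$. Let $z_{true}\in\mathbb{R}^{2n}$ be the vector of true value and second moment functions, i.e. $z_{true}=Tz_{true}$, and let $z^*$ be the unique fixed point of $\Pi T$. Then $$\|z_{true}-z^*\|_\alpha\le\frac{1}{1-\beta}\,\|z_{true}-\Pi z_{true}\|_\alpha .$$
   Context: Setting. $X=\{1,\dots,n\}$ is a finite state set and $x^*\notin X$ is an absorbing terminal state. A fixed policy induces a time-homogeneous Markov chain $(x_k)_{k\ge0}$ on $X\cup\{x^*\}$ with transition probabilities $P(y|x)$, $x\in X$, $y\in X\cup\{x^*\}$. The reward is a deterministic function $r:X\to\mathbb{R}$. The policy is proper if, from every initial state, there is positive probability that $x^*$ is reached after at most $n$ transitions. Let $P\in\mathbb{R}^{n\times n}$ be the matrix $P_{x,y}=P(y|x)$, $x,y\in X$ (the terminal state is excluded), let $r\in\mathbb{R}^n$ also denote the reward vector, and $R=\mathrm{diag}(r)$. Occupancy weights. The initial state $x_0$ is drawn from a fixed distribution $\zeta_0$ on $X$. Let $q(x)=\sum_{t=0}^\infty\mathrm{Prob}(x_t=x)$ for $x\in X$, and $\|y\|_q=\sqrt{\sum_{i=1}^n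 q(i)y(i)^2}$ for $y\in\mathbb{R}^n$. Operators. For $z\in\mathbb{R}^{2n}$, $z_J$ and $z_M$ denote its first and last $n$ components. The map $T:\mathbb{R}^{2n}\to\mathbb{R}^{2n}$ is $$[Tz]_J=r+Pz_J,\qquad [Tz]_M=Rr+2RPz_J+Pz_M;$$ for a proper policy $T$ has a unique fixed point. $\Phi_J\in\mathbb{R}^{n\times l_J}$ and $\Phi_M\in\mathbb{R}^{n\times l_M}$ are feature matrices (one row per state), $S_J,S_M\subseteq\mathbb{R}^n$ are their column spaces, $\Pi_J,\Pi_M$ are the orthogonal projections of $\mathbb{R}^n$ onto $S_J,S_M$ with respect to $\|\cdot\|_q$, and $\Pi$ is the linear map on $\mathbb{R}^{2n}$ given by $[\Pi z]_J=\Pi_Jz_J$, $[\Pi z]_M=\Pi_Mz_M$. Norms. Fix norms $\|\cdot\|_J,\|\cdot\|_M$ on $\mathbb{R}^n$ and constants $\beta_J,\beta_M<1$ such that $\|\Pi_JPy\|_J\le\beta_J\|y\|_J$ and $\|\Pi_MPy\|_M\le\beta_M\|y\|_M$ for all $y\in\mathbb{R}^n$ (under the hypotheses of the claim such norms are known to exist). For $0<\alpha<1$ the $\alpha$-weighted norm on $\mathbb{R}^{2n}$ is $\|z\|_\alpha=\alpha\|z_J\|_J+(1-\alpha)\|z_M\|_M$. Under the hypotheses of the claim, $\alpha$ and $\beta$ as required in the claim exist. *)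

theory Defs
  imports "HOL-Probability.Probability"
begin

text \<open>
  States are the elements of the finite type \<open>'n\<close>; on \<open>'n option\<close>, the value \<open>None\<close> is the
  absorbing terminal state and \<open>pmf (K x) (Some y)\<close>, \<open>pmf (K x) None\<close> are the transition
  probabilities out of \<open>x\<close>.
\<close>

definition chain_step :: "('n \<Rightarrow> 'n option pmf) \<Rightarrow> 'n option \<Rightarrow> 'n option pmf" where
  "chain_step K s = (case s of None \<Rightarrow> return_pmf None | Some x \<Rightarrow> K x)"

text \<open>\<open>trajectory K \<mu> t\<close> is the joint law of \<open>[x\<^sub>0, \<dots>, x\<^sub>t]\<close> when \<open>x\<^sub>0\<close> has law \<open>\<mu>\<close>.\<close>

primrec trajectory ::
  "('n \<Rightarrow> 'n option pmf) \<Rightarrow> 'n option pmf \<Rightarrow> nat \<Rightarrow> 'n option list pmf" where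
  "trajectory K \<mu> 0 = map_pmf (\<lambda>s. [s]) \<mu>"
| "trajectory K \<mu> (Suc t) =
     bind_pmf (trajectory K \<mu> t) (\<lambda>xs. map_pmf (\<lambda>s. xs @ [s]) (chain_step K (last xs)))"

definition proper :: "('n::finite \<Rightarrow> 'n option pmf) \<Rightarrow> bool" where
  "proper K \<longleftrightarrow>
     (\<forall>x. measure_pmf.prob (trajectory K (return_pmf (Some x)) CARD('n)) {xs. None \<in> set xs} > 0)"

text \<open>The series below converges whenever \<open>K\<close> is proper.\<close>

definition occupancy :: "('n \<Rightarrow> 'n option pmf) \<Rightarrow> 'n pmf \<Rightarrow> 'n \<Rightarrow> real" where
  "occupancy K \<zeta>\<^sub>0 x =
     (\<Sum>t. measure_pmf.prob (trajectory K (map_pmf Some \<zeta>\<^sub>0) t) {xs. xs ! t = Some x})"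

definition transition_matrix :: "('n::finite \<Rightarrow> 'n option pmf) \<Rightarrow> real^'n^'n" where
  "transition_matrix K = (\<chi> x y. pmf (K x) (Some y))"

definition diag :: "real^'n \<Rightarrow> real^'n^'n" where
  "diag r = (\<chi> x y. if x = y then r $ x else 0)"

definition wdot :: "('n::finite \<Rightarrow> real) \<Rightarrow> real^'n \<Rightarrow> real^'n \<Rightarrow> real" where
  "wdot q u v = (\<Sum>i\<in>UNIV. q i * u $ i * v $ i)"

definition wnorm :: "('n::finite \<Rightarrow> real) \<Rightarrow> real^'n \<Rightarrow> real" where
  "wnorm q y = sqrt (\<Sum>i\<in>UNIV. q i * (y $ i)\<^sup>2)"

text \<open>
  Orthogonal projection for the inner product \<open>wdot q\<close>, which induces \<open>wnorm q\<close>
  (\<open>wnorm_eq_wdot\<close>); for positive weights and a subspace \<open>S\<close> the description is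
  well-defined (\<open>wproj_ex1\<close>).
\<close>

definition wproj :: "('n::finite \<Rightarrow> real) \<Rightarrow> (real^'n) set \<Rightarrow> real^'n \<Rightarrow> real^'n" where
  "wproj q S y = (THE p. p \<in> S \<and> (\<forall>s\<in>S. wdot q (y - p) s = 0))"

lemma wnorm_eq_wdot: "wnorm q y = sqrt (wdot q y y)"
  by (simp add: wnorm_def wdot_def power2_eq_square mult.assoc)

lemma wproj_ex1:
  fixes y :: "real^'n"
  assumes q: "\<And>i. q i > 0" and S: "subspace S"
  shows "\<exists>!p. p \<in> S \<and> (\<forall>s\<in>S. wdot q (y - p) s = 0)"
proof -
  define D where "D = (\<lambda>u :: real^'n. \<chi> i. sqrt (q i) * u $ i)"
  have lin: "linear D"
    by (rule linearI) (auto simp: D_def vec_eq_iff algebra_simps)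
  have DD: "D u \<bullet> D v = wdot q u v" for u v
    using q by (auto simp: D_def inner_vec_def wdot_def less_imp_le intro!: sum.cong)
  have sub: "subspace (D ` S)"
    using linear_subspace_image[OF lin S] .
  obtain a b where a: "a \<in> span (D ` S)" and b: "\<And>w. w \<in> span (D ` S) \<Longrightarrow> orthogonal b w"
    and ab: "D y = a + b"
    using orthogonal_subspace_decomp_exists[of "D ` S" "D y"] by metis
  have sp: "span (D ` S) = D ` S"
    using sub by (simp add: span_eq_iff)
  obtain p where p: "p \<in> S" "a = D p"
    using a unfolding sp by auto
  show ?thesis
  proof (rule ex1I[of _ p], intro conjI ballI)
    fix s assume "s \<in> S"
    hence "b \<bullet> D s = 0"
      using b[of "D s"] sp by (auto simp: orthogonal_def)
    moreover have "b = D (y - p)"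
      using ab p by (simp add: linear_diff[OF lin])
    ultimately show "wdot q (y - p) s = 0"
      by (simp add: DD)
  next
    fix p' assume p': "p' \<in> S \<and> (\<forall>s\<in>S. wdot q (y - p') s = 0)"
    have d: "p' - p \<in> S"
      using p' p S by (simp add: subspace_diff)
    have "b \<bullet> D (p' - p) = 0"
      using b[of "D (p' - p)"] d sp by (auto simp: orthogonal_def)
    hence "D (y - p) \<bullet> D (p' - p) = 0"
      using ab p by (simp add: linear_diff[OF lin])
    moreover have "D (y - p') \<bullet> D (p' - p) = 0"
      using p' d by (simp add: DD)
    ultimately have "D (p' - p) \<bullet> D (p' - p) = 0"
      by (simp add: linear_diff[OF lin] inner_diff_left)
    hence "D (p' - p) = 0" by simp
    thus "p' = p"
      using q by (auto simp: D_def vec_eq_iff) (metis less_irrefl)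
  qed (rule p)
qed

text \<open>A vector \<open>z\<close> of length \<open>2n\<close> is represented by the pair \<open>(z\<^sub>J, z\<^sub>M)\<close> of its halves.\<close>

definition T_op ::
  "real^'n^'n \<Rightarrow> real^'n \<Rightarrow> (real^'n) \<times> (real^'n) \<Rightarrow> (real^'n) \<times> (real^'n)" where
  "T_op P r z =
     (r + P *v fst z,
      diag r *v r + 2 *\<^sub>R ((diag r ** P) *v fst z) + P *v snd z)"

definition Proj_op ::
  "('n::finite \<Rightarrow> real) \<Rightarrow> real^'lJ^'n \<Rightarrow> real^'lM^'n
     \<Rightarrow> (real^'n) \<times> (real^'n) \<Rightarrow> (real^'n) \<times> (real^'n)" where
  "Proj_op q \<Phi>\<^sub>J \<Phi>\<^sub>M z =
     (wproj q (span (columns \<Phi>\<^sub>J)) (fst z), wproj q (span (columns \<Phi>\<^sub>M)) (snd z))"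

definition is_norm :: "('a::real_vector \<Rightarrow> real) \<Rightarrow> bool" where
  "is_norm N \<longleftrightarrow>
     (\<forall>x. N x \<ge> 0) \<and> (\<forall>x. N x = 0 \<longleftrightarrow> x = 0) \<and>
     (\<forall>c x. N (c *\<^sub>R x) = \<bar>c\<bar> * N x) \<and> (\<forall>x y. N (x + y) \<le> N x + N y)"

definition weighted_norm ::
  "real \<Rightarrow> ('a \<Rightarrow> real) \<Rightarrow> ('b \<Rightarrow> real) \<Rightarrow> 'a \<times> 'b \<Rightarrow> real" where
  "weighted_norm \<alpha> N\<^sub>J N\<^sub>M z = \<alpha> * N\<^sub>J (fst z) + (1 - \<alpha>) * N\<^sub>M (snd z)"

end

theory Submission
  imports Defs
begin

text \<open>A contraction that moves a point \<open>x\<close> by a distance d has its fixed point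
  within d / (1 - \<beta>) of \<open>x\<close>. Apply this to the composition of \<open>Proj\<close>
  with \<open>T\<close> at the point \<open>z_true\<close>: since \<open>T\<close> fixes
  \<open>z_true\<close>, the composition sends it to \<open>Proj z_true\<close>, so d is exactly the
  projection error. The general bound is \<open>contraction_fixed_point_error\<close>;
  \<open>is_norm_weighted_norm\<close> makes it available for the \<alpha>-weighted norm.\<close>

lemma is_norm_weighted_norm:
  assumes "is_norm N\<^sub>J" "is_norm N\<^sub>M" "0 < \<alpha>" "\<alpha> < 1"
  shows "is_norm (weighted_norm \<alpha> N\<^sub>J N\<^sub>M)"
  unfolding is_norm_def
proof (intro conjI allI)
  fix x y :: "'a \<times> 'b" and c :: real
  have nonneg: "0 \<le> \<alpha> * N\<^sub>J (fst x)" "0 \<le> (1 - \<alpha>) * N\<^sub>M (snd x)"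
    using assms by (simp_all add: is_norm_def)
  show "0 \<le> weighted_norm \<alpha> N\<^sub>J N\<^sub>M x"
    using nonneg by (simp add: weighted_norm_def)
  \<comment> \<open>Nonnegative summands with sum zero both vanish; as \<alpha> and 1 - \<alpha> are
    strictly positive, both components of \<open>x\<close> are then zero.\<close>
  show "weighted_norm \<alpha> N\<^sub>J N\<^sub>M x = 0 \<longleftrightarrow> x = 0"
    using assms by (simp add: weighted_norm_def add_nonneg_eq_0_iff[OF nonneg]
        is_norm_def prod_eq_iff)
  show "weighted_norm \<alpha> N\<^sub>J N\<^sub>M (c *\<^sub>R x) = \<bar>c\<bar> * weighted_norm \<alpha> N\<^sub>J N\<^sub>M x"
    using assms by (simp add: weighted_norm_def is_norm_def algebra_simps)
  have "\<alpha> * N\<^sub>J (fst (x + y)) \<le> \<alpha> * (N\<^sub>J (fst x) + N\<^sub>J (fst y))"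
    "(1 - \<alpha>) * N\<^sub>M (snd (x + y)) \<le> (1 - \<alpha>) * (N\<^sub>M (snd x) + N\<^sub>M (snd y))"
    using assms by (auto simp: is_norm_def intro!: mult_left_mono)
  thus "weighted_norm \<alpha> N\<^sub>J N\<^sub>M (x + y) \<le> weighted_norm \<alpha> N\<^sub>J N\<^sub>M x + weighted_norm \<alpha> N\<^sub>J N\<^sub>M y"
    by (simp add: weighted_norm_def algebra_simps)
qed

text \<open>The route from \<open>x\<close> to \<open>z\<close> passes through \<open>F x\<close>:
  the first leg is the displacement of \<open>x\<close>, and the second joins two images under
  \<open>F\<close>, so it is at most \<beta> times the distance being estimated.\<close>

lemma contraction_fixed_point_error:
  assumes N: "is_norm N" and "\<beta> < 1"
    and contraction: "\<And>x y. N (F x - F y) \<le> \<beta> * N (x - y)"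
    and fixed: "z = F z"
  shows "N (x - z) \<le> 1 / (1 - \<beta>) * N (x - F x)"
proof -
  have "N (x - z) = N ((x - F x) + (F x - F z))"
    using fixed by simp
  also have "\<dots> \<le> N (x - F x) + N (F x - F z)"
    using N unfolding is_norm_def by blast
  also have "\<dots> \<le> N (x - F x) + \<beta> * N (x - z)"
    using contraction by simp
  \<comment> \<open>The unknown distance occurs on both sides; collecting it leaves the factor 1 -
    \<beta>, which is positive and can be divided out.\<close>
  finally show ?thesis
    using \<open>\<beta> < 1\<close> by (simp add: field_simps)
qed

theorem lemma8:
  fixes K :: "'n::finite \<Rightarrow> 'n option pmf"
    and \<zeta>\<^sub>0 :: "'n pmf"
    and r :: "real^'n"
    and \<Phi>\<^sub>J :: "real^'lJ^'n" and \<Phi>\<^sub>M :: "real^'lM^'n"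
    and N\<^sub>J N\<^sub>M :: "real^'n \<Rightarrow> real"
    and \<beta>\<^sub>J \<beta>\<^sub>M \<alpha> \<beta> :: real
    and z_true z_star :: "(real^'n) \<times> (real^'n)"
  defines "P \<equiv> transition_matrix K"
    and "q \<equiv> occupancy K \<zeta>\<^sub>0"
  defines "T \<equiv> T_op P r"
    and "Proj \<equiv> Proj_op q \<Phi>\<^sub>J \<Phi>\<^sub>M"
    and "N \<equiv> weighted_norm \<alpha> N\<^sub>J N\<^sub>M"
  assumes "proper K"
    and "rank \<Phi>\<^sub>J = CARD('lJ)" and "rank \<Phi>\<^sub>M = CARD('lM)"
    and "\<And>x. q x > 0"
    and "is_norm N\<^sub>J" and "is_norm N\<^sub>M"
    and "\<beta>\<^sub>J < 1" and "\<beta>\<^sub>M < 1"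
    and "\<And>y. N\<^sub>J (wproj q (span (columns \<Phi>\<^sub>J)) (P *v y)) \<le> \<beta>\<^sub>J * N\<^sub>J y"
    and "\<And>y. N\<^sub>M (wproj q (span (columns \<Phi>\<^sub>M)) (P *v y)) \<le> \<beta>\<^sub>M * N\<^sub>M y"
    and "0 < \<alpha>" and "\<alpha> < 1" and "\<beta> < 1"
    and "\<And>z1 z2. N (Proj (T z1) - Proj (T z2)) \<le> \<beta> * N (z1 - z2)"
    and "z_true = T z_true"
    and "z_star = Proj (T z_star)"
  shows "N (z_true - z_star) \<le> 1 / (1 - \<beta>) * N (z_true - Proj z_true)"
proof -
  have "is_norm N"
    unfolding N_def
    using \<open>is_norm N\<^sub>J\<close> \<open>is_norm N\<^sub>M\<close> \<open>0 < \<alpha>\<close> \<open>\<alpha> < 1\<close> by (rule is_norm_weighted_norm)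
  hence "N (z_true - z_star) \<le> 1 / (1 - \<beta>) * N (z_true - Proj (T z_true))"
    using \<open>\<beta> < 1\<close>
      \<open>\<And>z1 z2. N (Proj (T z1) - Proj (T z2)) \<le> \<beta> * N (z1 - z2)\<close>
      \<open>z_star = Proj (T z_star)\<close>
    by (rule contraction_fixed_point_error)
  \<comment> \<open>The bound so far involves the displacement of \<open>z_true\<close> under the
    composition; the fixed point equation of \<open>T\<close> turns this into the projection
    error.\<close>
  thus ?thesis
    using \<open>z_true = T z_true\<close> by simp
qed

end
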